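(* Let $a_1,a_2,a_3\in\mathbb C$ with $a_3\notin\mathbb Z$. Then the operators given in the context define on the vector space $V(a_1,a_2,a_3)=\mathrm{span}_{\mathbb C}\{\mathbf v_{ijk}: i,j,k\in\mathbb Z\}$ (with the $\mathbf v_{ijk}$ linearly independent) the structure of a module over the simple Lie algebra of type $G_2$.
   Context: The Lie algebra of type $G_2$ is realized by $7\times7$ matrices, spanned by (with $E_{ij}$ the matrix units) $e_{01}=E_{31}+E_{64}$, $f_{01}=E_{13}+E_{46}$, $e_{10}=2E_{17}+E_{23}-E_{45}-E_{76}$, $f_{10}=E_{32}-E_{54}-2E_{67}+E_{71}$, $e_{11}=-E_{21}+2E_{37}-E_{65}+E_{74}$, $f_{11}=-E_{12}+2E_{47}-E_{56}+E_{73}$, $e_{21}=E_{14}+2E_{27}+E_{36}+E_{75}$, $f_{21}=E_{41}+2E_{57}+E_{63}+E_{72}$, $e_{31}=E_{15}+E_{26}$, $f_{31}=E_{51}+E_{62}$, $e_{32}=-E_{24}+E_{35}$, $f_{32}=-E_{42}+E_{53}$, $h_{01}=-E_{11}+E_{33}-E_{44}+E_{66}$, $h_{10}=2E_{11}+E_{22}-E_{33}+E_{44}-E_{55}-2E_{66}$; also $h_{21}=2h_{10}+3h_{01}$, $h_{11}=h_{10}+3h_{01}$, $h_{31}=h_{10}+h_{01}$, $h_{32}=h_{10}+2h_{01}$. Coefficients, for $i,j,k\in\mathbb Z$: $h_{01}(i,j)=a_1+2i-j$, $h_{21}(i,j)=a_2+j$, $h_{10}(i,j)=\frac12(h_{21}(i,j)-3h_{01}(i,j))$,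 $h_{11}(i,j)=\frac12(h_{21}(i,j)+3h_{01}(i,j))$, $h_{31}(i,j)=\frac12(h_{21}(i,j)-h_{01}(i,j))$, $h_{32}(i,j)=\frac12(h_{21}(i,j)+h_{01}(i,j))$, $s_{jk}=a_3-j+2k-1$, $S^+_{ijk}=\frac12(a_1+a_3+2i-2j+2k-1)$, $S^-_{ik}=\frac12(-a_1+a_3-2i+2k-1)$, $T^+_{jk}=\frac12(3s_{jk}+h_{21}(0,j))=\frac12(a_2+3a_3-2j+6k-3)$, $T^-_{jk}=\frac12(3s_{jk}-h_{21}(0,j))=\frac12(-a_2+3a_3-4j+6k-3)$, $A^+_{jk}=\dfrac{T^-_{j-1,k-1}T^+_{jk}T^+_{j+1,k}}{9s_{jk}s_{j+1,k}}$, $A^-_{jk}=\dfrac{T^-_{j-1,k-1}T^-_{jk}T^+_{j+1,k}}{9s_{jk}s_{j+1,k}}$, $B^+_{jk}=\dfrac{T^+_{j-1,k}T^+_{jk}T^+_{j+1,k}}{27s_{jk}s_{j+1,k}}$, $B^-_{jk}=\dfrac{T^-_{j-1,k-1}T^-_{jk}T^-_{j+1,k+1}}{27s_{jk}s_{j+1,k}}$. Operators: $h_{ab}\mathbf v_{ijk}=h_{ab}(i,j)\mathbf v_{ijk}$ for $ab\in\{01,10,11,21,31,32\}$, $e_{01}\mathbf v_{ijk}=S^+_{ijk}\mathbf v_{i+1,j,k}$, $f_{01}\mathbf v_{ijk}=S^-_{ik}\mathbf v_{i-1,j,k}$, $e_{21}\mathbf v_{ijk}=T^+_{j+1,k}\mathbf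 v_{i+1,j+2,k+1}$, $f_{21}\mathbf v_{ijk}=T^-_{j-1,k-1}\mathbf v_{i-1,j-2,k-1}$, $e_{10}\mathbf v_{ijk}=3\mathbf v_{i,j+1,k}+A^+_{jk}S^-_{ik}\mathbf v_{i,j+1,k+1}$, $f_{10}\mathbf v_{ijk}=-3\mathbf v_{i,j-1,k-1}-A^-_{jk}S^+_{ijk}\mathbf v_{i,j-1,k}$, $e_{11}\mathbf v_{ijk}=-3\mathbf v_{i+1,j+1,k}+A^+_{jk}S^+_{i+1,j+1,k}\mathbf v_{i+1,j+1,k+1}$, $f_{11}\mathbf v_{ijk}=-3\mathbf v_{i-1,j-1,k-1}+A^-_{jk}S^-_{i+1,k+1}\mathbf v_{i-1,j-1,k}$, $e_{31}\mathbf v_{ijk}=\mathbf v_{i+1,j+3,k+1}-B^+_{jk}S^-_{i+1,k+1}\mathbf v_{i+1,j+3,k+2}$, $f_{31}\mathbf v_{ijk}=\mathbf v_{i-1,j-3,k-2}-B^-_{jk}S^+_{i+1,j+1,k}\mathbf v_{i-1,j-3,k-1}$, $e_{32}\mathbf v_{ijk}=-\mathbf v_{i+2,j+3,k+1}-B^+_{jk}S^+_{i+1,j+1,k}\mathbf v_{i+2,j+3,k+2}$, $f_{32}\mathbf v_{ijk}=\mathbf v_{i-2,j-3,k-2}+B^-_{jk}S^-_{i+1,k+1}\mathbf v_{i-2,j-3,k-1}$. *)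

theory Defs
  imports "HOL-Analysis.Analysis" "HOL-Library.Poly_Mapping"
begin

locale lie_algebra = vector_space scale
  for scale :: "'k::field \<Rightarrow> 'g::ab_group_add \<Rightarrow> 'g" +
  fixes L :: "'g set"
    and bracket :: "'g \<Rightarrow> 'g \<Rightarrow> 'g"
  assumes subspace_carrier: "subspace L"
    and bracket_closed: "\<lbrakk>x \<in> L; y \<in> L\<rbrakk> \<Longrightarrow> bracket x y \<in> L"
    and bracket_add_left:
      "\<lbrakk>x \<in> L; y \<in> L; z \<in> L\<rbrakk> \<Longrightarrow> bracket (x + y) z = bracket x z + bracket y z"
    and bracket_add_right:
      "\<lbrakk>x \<in> L; y \<in> L; z \<in> L\<rbrakk> \<Longrightarrow> bracket x (y + z) = bracket x y + bracket x z"
    and bracket_scale_left: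
      "\<lbrakk>x \<in> L; y \<in> L\<rbrakk> \<Longrightarrow> bracket (scale c x) y = scale c (bracket x y)"
    and bracket_scale_right:
      "\<lbrakk>x \<in> L; y \<in> L\<rbrakk> \<Longrightarrow> bracket x (scale c y) = scale c (bracket x y)"
    and bracket_self: "x \<in> L \<Longrightarrow> bracket x x = 0"
    and jacobi:
      "\<lbrakk>x \<in> L; y \<in> L; z \<in> L\<rbrakk> \<Longrightarrow>
        bracket x (bracket y z) + bracket y (bracket z x) + bracket z (bracket x y) = 0"

text \<open>The underlying vector space of the module is the whole type \<open>'v\<close>.  Nothing is
  required of \<open>act x\<close> for \<open>x\<close> outside \<open>L\<close>.\<close>

locale lie_module = lie_algebra scale L bracket + V: vector_space scaleV
  for scale :: "'k::field \<Rightarrow> 'g::ab_group_add \<Rightarrow> 'g"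
    and L :: "'g set"
    and bracket :: "'g \<Rightarrow> 'g \<Rightarrow> 'g"
    and scaleV :: "'k \<Rightarrow> 'v::ab_group_add \<Rightarrow> 'v" +
  fixes act :: "'g \<Rightarrow> 'v \<Rightarrow> 'v"
  assumes act_linear: "x \<in> L \<Longrightarrow> Vector_Spaces.linear scaleV scaleV (act x)"
    and act_add: "\<lbrakk>x \<in> L; y \<in> L\<rbrakk> \<Longrightarrow> act (x + y) u = act x u + act y u"
    and act_scale: "x \<in> L \<Longrightarrow> act (scale c x) u = scaleV c (act x u)"
    and act_bracket:
      "\<lbrakk>x \<in> L; y \<in> L\<rbrakk> \<Longrightarrow> act (bracket x y) u = act x (act y u) - act y (act x u)"

type_synonym mat7 = "complex ^ 7 ^ 7"

text \<open>In the index type \<open>7\<close> the numerals \<open>1, \<dots>, 7\<close> are pairwise distinct and exhaust the type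
  (with \<open>7 = 0\<close>), so they serve directly as the row and column labels.\<close>

definition mat_unit :: "7 \<Rightarrow> 7 \<Rightarrow> mat7" where
  "mat_unit p q = (\<chi> i j. if i = p \<and> j = q then 1 else 0)"

definition mat_scale :: "complex \<Rightarrow> mat7 \<Rightarrow> mat7" where
  "mat_scale c A = (\<chi> i j. c * A $ i $ j)"

definition mat_bracket :: "mat7 \<Rightarrow> mat7 \<Rightarrow> mat7" where
  "mat_bracket A B = A ** B - B ** A"

interpretation mat7: vector_space mat_scale
  by unfold_locales (simp_all add: mat_scale_def vec_eq_iff algebra_simps)

definition h01_mat :: mat7 where
  "h01_mat = - mat_unit 1 1 + mat_unit 3 3 - mat_unit 4 4 + mat_unit 6 6"

definition h10_mat :: mat7 where
  "h10_mat = mat_scale 2 (mat_unit 1 1) + mat_unit 2 2 - mat_unit 3 3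
     + mat_unit 4 4 - mat_unit 5 5 - mat_scale 2 (mat_unit 6 6)"

datatype g2_symbol =
    E01 | E10 | E11 | E21 | E31 | E32
  | F01 | F10 | F11 | F21 | F31 | F32
  | H01 | H10 | H11 | H21 | H31 | H32

fun g2_mat :: "g2_symbol \<Rightarrow> mat7" where
  "g2_mat E01 = mat_unit 3 1 + mat_unit 6 4"
| "g2_mat F01 = mat_unit 1 3 + mat_unit 4 6"
| "g2_mat E10 = mat_scale 2 (mat_unit 1 7) + mat_unit 2 3 - mat_unit 4 5 - mat_unit 7 6"
| "g2_mat F10 = mat_unit 3 2 - mat_unit 5 4 - mat_scale 2 (mat_unit 6 7) + mat_unit 7 1"
| "g2_mat E11 = - mat_unit 2 1 + mat_scale 2 (mat_unit 3 7) - mat_unit 6 5 + mat_unit 7 4"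
| "g2_mat F11 = - mat_unit 1 2 + mat_scale 2 (mat_unit 4 7) - mat_unit 5 6 + mat_unit 7 3"
| "g2_mat E21 = mat_unit 1 4 + mat_scale 2 (mat_unit 2 7) + mat_unit 3 6 + mat_unit 7 5"
| "g2_mat F21 = mat_unit 4 1 + mat_scale 2 (mat_unit 5 7) + mat_unit 6 3 + mat_unit 7 2"
| "g2_mat E31 = mat_unit 1 5 + mat_unit 2 6"
| "g2_mat F31 = mat_unit 5 1 + mat_unit 6 2"
| "g2_mat E32 = - mat_unit 2 4 + mat_unit 3 5"
| "g2_mat F32 = - mat_unit 4 2 + mat_unit 5 3"
| "g2_mat H01 = h01_mat"
| "g2_mat H10 = h10_mat"
| "g2_mat H21 = mat_scale 2 h10_mat + mat_scale 3 h01_mat"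
| "g2_mat H11 = h10_mat + mat_scale 3 h01_mat"
| "g2_mat H31 = h10_mat + h01_mat"
| "g2_mat H32 = h10_mat + mat_scale 2 h01_mat"

definition g2 :: "mat7 set" where
  "g2 = mat7.span (g2_mat `
     {E01, F01, E10, F10, E11, F11, E21, F21, E31, F31, E32, F32, H01, H10})"

text \<open>Finitely supported functions on \<open>\<int>\<^sup>3\<close>, i.e. the free complex vector space on \<open>\<int>\<^sup>3\<close>.\<close>

type_synonym Vspace = "(int \<times> int \<times> int) \<Rightarrow>\<^sub>0 complex"

definition vscale :: "complex \<Rightarrow> Vspace \<Rightarrow> Vspace" (infixr "\<odot>" 75) where
  "c \<odot> u = Poly_Mapping.map ((*) c) u"

definition vb :: "int \<Rightarrow> int \<Rightarrow> int \<Rightarrow> Vspace" where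
  "vb i j k = Poly_Mapping.single (i, j, k) 1"

lemma lookup_vscale [simp]: "Poly_Mapping.lookup (c \<odot> u) p = c * Poly_Mapping.lookup u p"
  by (simp add: vscale_def Poly_Mapping.map.rep_eq when_def)

interpretation Vsp: vector_space vscale
  by unfold_locales (auto intro!: poly_mapping_eqI simp: lookup_add algebra_simps)

lemma vb_inject: "vb i j k = vb i' j' k' \<longleftrightarrow> i = i' \<and> j = j' \<and> k = k'"
  unfolding vb_def
  by (metis Pair_inject lookup_single_eq lookup_single_not_eq zero_neq_one)

lemma vb_sum: "u = (\<Sum>p\<in>Poly_Mapping.keys u. Poly_Mapping.lookup u p \<odot> (\<lambda>(i, j, k). vb i j k) p)"
  by (rule poly_mapping_eqI)
    (auto simp: lookup_sum vb_def lookup_single when_def in_keys_iff if_distrib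
      split: prod.split cong: if_cong)

lemma span_vb: "Vsp.span (range (\<lambda>(i, j, k). vb i j k)) = UNIV"
proof -
  have "u \<in> Vsp.span (range (\<lambda>(i, j, k). vb i j k))" for u
    by (subst vb_sum) (intro Vsp.span_sum Vsp.span_scale Vsp.span_base rangeI)
  then show ?thesis by blast
qed

lemma independent_vb: "Vsp.independent (range (\<lambda>(i, j, k). vb i j k))"
proof -
  have *: "c p = 0"
    if "finite A" "(\<Sum>p\<in>A. c p \<odot> (\<lambda>(i, j, k). vb i j k) p) = 0" "p \<in> A" for A c p
  proof -
    have "c p = (\<Sum>q\<in>A. if q = p then c q else 0)"
      using that by simp
    also have "\<dots> = Poly_Mapping.lookup (\<Sum>q\<in>A. c q \<odot> (\<lambda>(i, j, k). vb i j k) q) p"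
      unfolding lookup_sum by (rule sum.cong) (auto simp: vb_def lookup_single when_def)
    finally show ?thesis
      using that by simp
  qed
  have "u v = 0"
    if T: "finite T" "T \<subseteq> range (\<lambda>(i, j, k). vb i j k)" "(\<Sum>v\<in>T. u v \<odot> v) = 0" "v \<in> T"
    for T u v
  proof -
    obtain A where A: "inj_on (\<lambda>(i, j, k). vb i j k) A" "T = (\<lambda>(i, j, k). vb i j k) ` A"
      using T(2) by (meson subset_image_inj)
    then have "finite A"
      using T(1) finite_imageD by blast
    moreover have "(\<Sum>p\<in>A. u ((\<lambda>(i, j, k). vb i j k) p) \<odot> (\<lambda>(i, j, k). vb i j k) p) = 0"
      using T(3) A by (simp add: sum.reindex o_def)
    ultimately show ?thesis
      using \<open>v \<in> T\<close> A(2) *[of A "\<lambda>p. u ((\<lambda>(i, j, k). vb i j k) p)"] by blast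
  qed
  then show ?thesis
    unfolding Vsp.dependent_explicit by blast
qed

context
  fixes a1 a2 a3 :: complex
begin

definition h01_co :: "int \<Rightarrow> int \<Rightarrow> complex" where
  "h01_co i j = a1 + 2 * of_int i - of_int j"

text \<open>\<open>h\<^sub>2\<^sub>1(i,j)\<close> does not depend on \<open>i\<close>; the argument is kept for uniformity.\<close>

definition h21_co :: "int \<Rightarrow> int \<Rightarrow> complex" where
  "h21_co i j = a2 + of_int j"

definition h10_co :: "int \<Rightarrow> int \<Rightarrow> complex" where
  "h10_co i j = (h21_co i j - 3 * h01_co i j) / 2"

definition h11_co :: "int \<Rightarrow> int \<Rightarrow> complex" where
  "h11_co i j = (h21_co i j + 3 * h01_co i j) / 2"

definition h31_co :: "int \<Rightarrow> int \<Rightarrow> complex" where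
  "h31_co i j = (h21_co i j - h01_co i j) / 2"

definition h32_co :: "int \<Rightarrow> int \<Rightarrow> complex" where
  "h32_co i j = (h21_co i j + h01_co i j) / 2"

definition s_co :: "int \<Rightarrow> int \<Rightarrow> complex" where
  "s_co j k = a3 - of_int j + 2 * of_int k - 1"

definition Sp :: "int \<Rightarrow> int \<Rightarrow> int \<Rightarrow> complex" where
  "Sp i j k = (a1 + a3 + 2 * of_int i - 2 * of_int j + 2 * of_int k - 1) / 2"

definition Sm :: "int \<Rightarrow> int \<Rightarrow> complex" where
  "Sm i k = (- a1 + a3 - 2 * of_int i + 2 * of_int k - 1) / 2"

definition Tp :: "int \<Rightarrow> int \<Rightarrow> complex" where
  "Tp j k = (3 * s_co j k + h21_co 0 j) / 2"

definition Tm :: "int \<Rightarrow> int \<Rightarrow> complex" where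
  "Tm j k = (3 * s_co j k - h21_co 0 j) / 2"

definition Ap :: "int \<Rightarrow> int \<Rightarrow> complex" where
  "Ap j k = Tm (j - 1) (k - 1) * Tp j k * Tp (j + 1) k / (9 * s_co j k * s_co (j + 1) k)"

definition Am :: "int \<Rightarrow> int \<Rightarrow> complex" where
  "Am j k = Tm (j - 1) (k - 1) * Tm j k * Tp (j + 1) k / (9 * s_co j k * s_co (j + 1) k)"

definition Bp :: "int \<Rightarrow> int \<Rightarrow> complex" where
  "Bp j k = Tp (j - 1) k * Tp j k * Tp (j + 1) k / (27 * s_co j k * s_co (j + 1) k)"

definition Bm :: "int \<Rightarrow> int \<Rightarrow> complex" where
  "Bm j k = Tm (j - 1) (k - 1) * Tm j k * Tm (j + 1) (k + 1) / (27 * s_co j k * s_co (j + 1) k)"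

text \<open>\<open>g2_op x i j k\<close> is the prescribed image of the basis vector \<open>vb i j k\<close> under \<open>x\<close>.\<close>

fun g2_op :: "g2_symbol \<Rightarrow> int \<Rightarrow> int \<Rightarrow> int \<Rightarrow> Vspace" where
  "g2_op H01 i j k = h01_co i j \<odot> vb i j k"
| "g2_op H10 i j k = h10_co i j \<odot> vb i j k"
| "g2_op H11 i j k = h11_co i j \<odot> vb i j k"
| "g2_op H21 i j k = h21_co i j \<odot> vb i j k"
| "g2_op H31 i j k = h31_co i j \<odot> vb i j k"
| "g2_op H32 i j k = h32_co i j \<odot> vb i j k"
| "g2_op E01 i j k = Sp i j k \<odot> vb (i + 1) j k"
| "g2_op F01 i j k = Sm i k \<odot> vb (i - 1) j k"
| "g2_op E21 i j k = Tp (j + 1) k \<odot> vb (i + 1) (j + 2) (k + 1)"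
| "g2_op F21 i j k = Tm (j - 1) (k - 1) \<odot> vb (i - 1) (j - 2) (k - 1)"
| "g2_op E10 i j k =
     3 \<odot> vb i (j + 1) k + (Ap j k * Sm i k) \<odot> vb i (j + 1) (k + 1)"
| "g2_op F10 i j k =
     - (3 \<odot> vb i (j - 1) (k - 1)) - (Am j k * Sp i j k) \<odot> vb i (j - 1) k"
| "g2_op E11 i j k =
     - (3 \<odot> vb (i + 1) (j + 1) k)
     + (Ap j k * Sp (i + 1) (j + 1) k) \<odot> vb (i + 1) (j + 1) (k + 1)"
| "g2_op F11 i j k =
     - (3 \<odot> vb (i - 1) (j - 1) (k - 1))
     + (Am j k * Sm (i + 1) (k + 1)) \<odot> vb (i - 1) (j - 1) k"
| "g2_op E31 i j k =
     vb (i + 1) (j + 3) (k + 1)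
     - (Bp j k * Sm (i + 1) (k + 1)) \<odot> vb (i + 1) (j + 3) (k + 2)"
| "g2_op F31 i j k =
     vb (i - 1) (j - 3) (k - 2)
     - (Bm j k * Sp (i + 1) (j + 1) k) \<odot> vb (i - 1) (j - 3) (k - 1)"
| "g2_op E32 i j k =
     - vb (i + 2) (j + 3) (k + 1)
     - (Bp j k * Sp (i + 1) (j + 1) k) \<odot> vb (i + 2) (j + 3) (k + 2)"
| "g2_op F32 i j k =
     vb (i - 2) (j - 3) (k - 2)
     + (Bm j k * Sm (i + 1) (k + 1)) \<odot> vb (i - 2) (j - 3) (k - 1)"

end

end

theory Submission
  imports Defs
begin

text \<open>
  Write \<open>\<rho>\<close> for the linear map from $G_2$ to the endomorphisms of \<open>V\<close> that takes the basis matrices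
  to the prescribed operators, and call a pair of matrices \<open>(x, y)\<close> compatible if \<open>[x, y]\<close> lies in
  $G_2$ and \<open>\<rho> [x, y] = [\<rho> x, \<rho> y]\<close>.  The theorem says that all pairs from $G_2$ are compatible.
  Checking the 91 pairs of basis elements is avoided by the grading of $G_2$ modulo 2.

  The even part is a copy of \<open>sl\<^sub>2 \<oplus> sl\<^sub>2\<close>, generated by \<open>e\<^sub>0\<^sub>1, f\<^sub>0\<^sub>1, e\<^sub>2\<^sub>1, f\<^sub>2\<^sub>1\<close>, whose operators move
  each basis vector to a multiple of one other.  The odd part is spanned by the root vectors
  \<open>e\<^sub>1\<^sub>0, e\<^sub>1\<^sub>1, e\<^sub>3\<^sub>1, e\<^sub>3\<^sub>2\<close> and their negatives; it is an irreducible module of the even part with highest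
  vector \<open>e\<^sub>3\<^sub>2\<close> and lowest vector \<open>f\<^sub>3\<^sub>2\<close>.  Two things are computed: the four even generators are
  compatible with the whole basis, and \<open>(e\<^sub>3\<^sub>2, f\<^sub>3\<^sub>2)\<close> is compatible.  The rest is formal.  By the Jacobi
  identity the elements compatible with everything are closed under brackets, so the whole even part is
  compatible with everything.  If \<open>z\<close> is such an element, then compatibility of \<open>(x, y)\<close> and
  \<open>(x, [z, y])\<close> gives that of \<open>([z, x], y)\<close> (\<open>compatible_bracket_left\<close>).  Since the raising operators
  \<open>e\<^sub>0\<^sub>1, e\<^sub>2\<^sub>1\<close> kill \<open>e\<^sub>3\<^sub>2\<close>, raising \<open>f\<^sub>3\<^sub>2\<close> shows that \<open>e\<^sub>3\<^sub>2\<close> is compatible with every odd element, and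
  lowering \<open>e\<^sub>3\<^sub>2\<close> then reaches all odd pairs (\<open>compatible_odd\<close>).

  The computations on \<open>V\<close> are reduced to the single vector \<open>v\<^sub>0\<^sub>0\<^sub>0\<close>: a translation of the lattice turns
  the module with parameters \<open>a\<^sub>1, a\<^sub>2, a\<^sub>3\<close> into the one with parameters
  \<open>a\<^sub>1 + 2i - j, a\<^sub>2 + j, a\<^sub>3 - j + 2k\<close> (\<open>pairing_g2_op_translate\<close>).  Near the origin the coefficients are
  rational functions of the values \<open>p = S\<^sup>+\<close>, \<open>t = T\<^sup>+\<close> and \<open>s = s\<^sub>0\<^sub>0\<close> at the origin, where \<open>S\<^sup>- = s - p\<close> and
  \<open>T\<^sup>- = 3s - t\<close>.  Up to integer factors their denominators are products of integer translates of \<open>s\<close>,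
  and these are nonzero because \<open>a\<^sub>3\<close> is not an integer.
\<close>

section \<open>Commutators of matrices\<close>

lemma matrix_add_distrib:
  "(A + B) ** C = A ** C + B ** C" "A ** (B + C) = A ** B + A ** C"
  for A B C :: mat7
  by (simp_all add: matrix_matrix_mult_def vec_eq_iff sum.distrib algebra_simps)

lemma matrix_diff_distrib:
  "(A - B) ** C = A ** C - B ** C" "A ** (B - C) = A ** B - A ** C"
  for A B C :: mat7
  by (simp_all add: matrix_matrix_mult_def vec_eq_iff sum_subtractf algebra_simps)

lemma mat_scale_numerals:
  "mat_scale 2 A = A + A" "mat_scale 3 A = A + A + A" "mat_scale (- c) A = - mat_scale c A"
  by (simp_all add: mat_scale_def vec_eq_iff)

lemma mat_scale_matrix_mul:
  "mat_scale c A ** B = mat_scale c (A ** B)" "A ** mat_scale c B = mat_scale c (A ** B)"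
  by (simp_all add: mat_scale_def matrix_matrix_mult_def vec_eq_iff sum_distrib_left mult_ac)

lemma mat_bracket_add:
  "mat_bracket (A + B) C = mat_bracket A C + mat_bracket B C"
  "mat_bracket A (B + C) = mat_bracket A B + mat_bracket A C"
  by (simp_all add: mat_bracket_def matrix_add_distrib)

lemma mat_bracket_scale:
  "mat_bracket (mat_scale c A) B = mat_scale c (mat_bracket A B)"
  "mat_bracket A (mat_scale c B) = mat_scale c (mat_bracket A B)"
  by (simp_all add: mat_bracket_def mat_scale_matrix_mul mat7.scale_right_diff_distrib)

lemma mat_bracket_zero: "mat_bracket 0 A = 0" "mat_bracket A 0 = 0"
  by (simp_all add: mat_bracket_def)

lemma mat_bracket_swap: "mat_bracket A B = - mat_bracket B A"
  by (simp add: mat_bracket_def)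

lemma mat_bracket_diff:
  "mat_bracket (A - B) C = mat_bracket A C - mat_bracket B C"
  "mat_bracket A (B - C) = mat_bracket A B - mat_bracket A C"
  by (simp_all add: mat_bracket_def matrix_diff_distrib)

lemma mat_bracket_minus:
  "mat_bracket (- A) B = - mat_bracket A B" "mat_bracket A (- B) = - mat_bracket A B"
  using mat_bracket_diff(1)[of 0 A B] mat_bracket_diff(2)[of A 0 B]
  by (simp_all add: mat_bracket_zero)

text \<open>The Jacobi identity in the form used throughout: bracketing with \<open>A\<close> is a derivation.\<close>

lemma mat_bracket_derivation:
  "mat_bracket (mat_bracket A B) C
     = mat_bracket A (mat_bracket B C) - mat_bracket B (mat_bracket A C)"
  by (simp add: mat_bracket_def matrix_mul_assoc matrix_diff_distrib algebra_simps)

lemma mat_unit_mult: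
  "mat_unit p q ** mat_unit r s = (if q = r then mat_unit p s else 0)"
proof -
  have "(\<Sum>k\<in>UNIV. (if i = p \<and> k = q then 1 else 0) * (if k = r \<and> j = s then 1 else (0::complex)))
      = (\<Sum>k\<in>UNIV. if k = q then (if i = p \<and> q = r \<and> j = s then 1 else 0) else 0)" for i j
    by (rule sum.cong) auto
  then show ?thesis
    by (simp add: mat_unit_def matrix_matrix_mult_def vec_eq_iff)
qed

lemma mat_bracket_mat_unit:
  "mat_bracket (mat_unit p q) (mat_unit r s)
     = (if q = r then mat_unit p s else 0) - (if s = p then mat_unit r q else 0)"
  by (simp add: mat_bracket_def mat_unit_mult)

lemmas mat_bracket_simps = mat_bracket_add mat_bracket_minus mat_bracket_diff mat_bracket_scale
  mat_bracket_zero mat_bracket_mat_unit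

section \<open>Brackets in $G_2$\<close>

definition g2_basis :: "g2_symbol set" where
  "g2_basis = {E01, F01, E10, F10, E11, F11, E21, F21, E31, F31, E32, F32, H01, H10}"

definition even_gens :: "g2_symbol set" where
  "even_gens = {E01, F01, E21, F21}"

text \<open>\<open>ad x y = (c, z)\<close> records \<open>[x, y] = c z\<close> for an even generator \<open>x\<close> and a basis symbol \<open>y\<close>.
  One multiple of one symbol suffices: a root vector takes a root space into a root space, or into
  the line through its own coroot, and \<open>h\<^sub>2\<^sub>1\<close> is itself a symbol.  The pair \<open>(0, H01)\<close> stands for a
  vanishing bracket.\<close>

fun ad :: "g2_symbol \<Rightarrow> g2_symbol \<Rightarrow> complex \<times> g2_symbol" where
  "ad E01 y = (case y of F01 \<Rightarrow> (1, H01) | E10 \<Rightarrow> (1, E11) | F11 \<Rightarrow> (-1, F10) | E31 \<Rightarrow> (1, E32)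
     | F32 \<Rightarrow> (-1, F31) | H01 \<Rightarrow> (-2, E01) | H10 \<Rightarrow> (3, E01) | _ \<Rightarrow> (0, H01))"
| "ad F01 y = (case y of E01 \<Rightarrow> (-1, H01) | F10 \<Rightarrow> (-1, F11) | E11 \<Rightarrow> (1, E10) | F31 \<Rightarrow> (-1, F32)
     | E32 \<Rightarrow> (1, E31) | H01 \<Rightarrow> (2, F01) | H10 \<Rightarrow> (-3, F01) | _ \<Rightarrow> (0, H01))"
| "ad E21 y = (case y of F21 \<Rightarrow> (1, H21) | E10 \<Rightarrow> (-3, E31) | F10 \<Rightarrow> (-2, E11) | E11 \<Rightarrow> (-3, E32)
     | F11 \<Rightarrow> (2, E10) | F31 \<Rightarrow> (1, F10) | F32 \<Rightarrow> (1, F11) | H10 \<Rightarrow> (-1, E21) | _ \<Rightarrow> (0, H01))"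
| "ad F21 y = (case y of E21 \<Rightarrow> (-1, H21) | F10 \<Rightarrow> (3, F31) | E10 \<Rightarrow> (2, F11) | F11 \<Rightarrow> (3, F32)
     | E11 \<Rightarrow> (-2, F10) | E31 \<Rightarrow> (-1, E10) | E32 \<Rightarrow> (-1, E11) | H10 \<Rightarrow> (1, F21) | _ \<Rightarrow> (0, H01))"
| "ad _ y = (0, H01)"

lemma mat_bracket_ad:
  assumes "x \<in> even_gens" "y \<in> g2_basis"
  shows "mat_bracket (g2_mat x) (g2_mat y) = mat_scale (fst (ad x y)) (g2_mat (snd (ad x y)))"
  using assms unfolding even_gens_def g2_basis_def
  by (elim insertE emptyE; hypsubst;
      simp add: h01_mat_def h10_mat_def mat_bracket_simps;
      simp add: mat_scale_numerals algebra_simps)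

lemma mat_bracket_E32_F32: "mat_bracket (g2_mat E32) (g2_mat F32) = g2_mat H32"
  by (simp add: h01_mat_def h10_mat_def mat_bracket_simps;
      simp add: mat_scale_numerals algebra_simps)

text \<open>The coordinates with respect to the 14 basis matrices.  Each root coordinate is read off at an
  entry where no other basis matrix is nonzero; \<open>h\<^sub>0\<^sub>1\<close> and \<open>h\<^sub>1\<^sub>0\<close> have the entries \<open>0, 1\<close> and \<open>1, -1\<close> at the
  places \<open>(2,2)\<close> and \<open>(3,3)\<close>.  The remaining symbols are not basis elements and get the value 0.\<close>

primrec g2_coord :: "g2_symbol \<Rightarrow> mat7 \<Rightarrow> complex" where
  "g2_coord E01 A = A $ 3 $ 1" | "g2_coord F01 A = A $ 1 $ 3"
| "g2_coord E10 A = A $ 2 $ 3" | "g2_coord F10 A = A $ 3 $ 2"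
| "g2_coord E11 A = - A $ 2 $ 1" | "g2_coord F11 A = - A $ 1 $ 2"
| "g2_coord E21 A = A $ 1 $ 4" | "g2_coord F21 A = A $ 4 $ 1"
| "g2_coord E31 A = A $ 1 $ 5" | "g2_coord F31 A = A $ 5 $ 1"
| "g2_coord E32 A = A $ 3 $ 5" | "g2_coord F32 A = A $ 5 $ 3"
| "g2_coord H01 A = A $ 2 $ 2 + A $ 3 $ 3" | "g2_coord H10 A = A $ 2 $ 2"
| "g2_coord H11 A = 0" | "g2_coord H21 A = 0" | "g2_coord H31 A = 0" | "g2_coord H32 A = 0"

lemma mat_unit_nth: "mat_unit p q $ i $ j = (if i = p \<and> j = q then 1 else 0)"
  by (simp add: mat_unit_def)

lemma mat_scale_nth: "mat_scale c A $ i $ j = c * A $ i $ j"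
  by (simp add: mat_scale_def)

lemma g2_coord_add: "g2_coord b (A + B) = g2_coord b A + g2_coord b B"
  by (cases b) simp_all

lemma g2_coord_scale: "g2_coord b (mat_scale c A) = c * g2_coord b A"
  by (cases b) (simp_all add: mat_scale_nth algebra_simps)

lemma g2_coord_basis:
  assumes "b \<in> g2_basis" "x \<in> g2_basis"
  shows "g2_coord b (g2_mat x) = (if b = x then 1 else 0)"
proof -
  have "\<forall>x\<in>g2_basis. \<forall>b\<in>g2_basis. g2_coord b (g2_mat x) = (if b = x then 1 else 0)"
    by (simp add: g2_basis_def mat_unit_nth mat_scale_nth h01_mat_def h10_mat_def)
  then show ?thesis using assms by blast
qed

section \<open>Linear extension and translation symmetry\<close>

definition lin_ext ::
  "(complex \<Rightarrow> 'w \<Rightarrow> 'w) \<Rightarrow> (int \<Rightarrow> int \<Rightarrow> int \<Rightarrow> 'w) \<Rightarrow> Vspace \<Rightarrow> 'w::ab_group_add" where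
  "lin_ext scl f u = (\<Sum>(i, j, k)\<in>Poly_Mapping.keys u. scl (Poly_Mapping.lookup u (i, j, k)) (f i j k))"

lemma lin_ext_superset:
  assumes "vector_space scl" "finite A" "Poly_Mapping.keys u \<subseteq> A"
  shows "lin_ext scl f u = (\<Sum>(i, j, k)\<in>A. scl (Poly_Mapping.lookup u (i, j, k)) (f i j k))"
proof -
  interpret vector_space scl by fact
  show ?thesis
    unfolding lin_ext_def using assms(2,3)
    by (intro sum.mono_neutral_left) (auto simp: in_keys_iff)
qed

lemma linear_lin_ext:
  assumes "vector_space scl"
  shows "Vector_Spaces.linear vscale scl (lin_ext scl f)"
proof -
  interpret W: vector_space scl by fact
  have "lin_ext scl f (u + v) = lin_ext scl f u + lin_ext scl f v" for u v
  proof -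
    let ?A = "Poly_Mapping.keys u \<union> Poly_Mapping.keys v"
    have "lin_ext scl f w = (\<Sum>(i, j, k)\<in>?A. scl (Poly_Mapping.lookup w (i, j, k)) (f i j k))"
      if "Poly_Mapping.keys w \<subseteq> ?A" for w
      using that by (intro lin_ext_superset assms) simp_all
    then show ?thesis
      by (simp add: Poly_Mapping.keys_add lookup_add W.scale_left_distrib sum.distrib case_prod_unfold)
  qed
  moreover have "lin_ext scl f (c \<odot> u) = scl c (lin_ext scl f u)" for c u
  proof -
    have "Poly_Mapping.keys (c \<odot> u) \<subseteq> Poly_Mapping.keys u"
      by (auto simp: in_keys_iff)
    then have "lin_ext scl f (c \<odot> u)
        = (\<Sum>(i, j, k)\<in>Poly_Mapping.keys u. scl (c * Poly_Mapping.lookup u (i, j, k)) (f i j k))"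
      using lin_ext_superset[OF assms, of "Poly_Mapping.keys u" "c \<odot> u"] by simp
    then show ?thesis
      by (simp add: lin_ext_def W.scale_sum_right case_prod_unfold)
  qed
  ultimately show ?thesis
    by unfold_locales simp_all
qed

lemma lin_ext_vb [simp]:
  assumes "vector_space scl"
  shows "lin_ext scl f (vb i j k) = f i j k"
proof -
  interpret vector_space scl by fact
  show ?thesis
    by (simp add: lin_ext_def vb_def)
qed

text \<open>The vectors \<open>vb i j k\<close> span the whole space, so they determine a linear map.\<close>

lemma linear_eq_on_vb:
  assumes "Vector_Spaces.linear vscale scl f" "Vector_Spaces.linear vscale scl g"
    and "\<And>i j k. f (vb i j k) = g (vb i j k)"
  shows "f u = g u"
proof -
  interpret f: Vector_Spaces.linear vscale scl f by fact
  interpret vector_space_pair vscale scl by unfold_locales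
  show ?thesis
    by (rule linear_eq_on[OF assms(1,2), of u "range (\<lambda>(i, j, k). vb i j k)"])
      (use assms(3) span_vb in auto)
qed

interpretation complex_space: vector_space "(*) :: complex \<Rightarrow> complex \<Rightarrow> complex"
  by unfold_locales (simp_all add: algebra_simps)

text \<open>The linear functional with the prescribed values on the basis vectors.  Equations between vectors
  are tested by applying all such functionals: this turns them into equations between complex numbers,
  in which the values \<open>w i j k\<close> are independent unknowns and ring arithmetic applies.\<close>

definition pairing :: "(int \<Rightarrow> int \<Rightarrow> int \<Rightarrow> complex) \<Rightarrow> Vspace \<Rightarrow> complex" where
  "pairing = lin_ext (*)"

lemma linear_pairing: "Vector_Spaces.linear vscale (*) (pairing w)"
  unfolding pairing_def by (rule linear_lin_ext) unfold_locales

interpretation pairing: Vector_Spaces.linear vscale "(*)" "pairing w" for w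
  by (rule linear_pairing)

lemma pairing_vb [simp]: "pairing w (vb i j k) = w i j k"
  unfolding pairing_def by (rule lin_ext_vb) unfold_locales

lemma pairing_eqI:
  assumes "\<And>w. pairing w u = pairing w v"
  shows "u = v"
proof (rule poly_mapping_eqI)
  fix p :: "int \<times> int \<times> int"
  let ?w = "\<lambda>l m n :: int. if (l, m, n) = p then 1 else (0::complex)"
  have "pairing ?w u = Poly_Mapping.lookup u p" for u
  proof (rule linear_eq_on_vb[OF linear_pairing])
    show "Vector_Spaces.linear vscale (*) (\<lambda>u. Poly_Mapping.lookup u p)"
      by unfold_locales (simp_all add: lookup_add)
    show "pairing ?w (vb i j k) = Poly_Mapping.lookup (vb i j k) p" for i j k
      by (simp only: pairing_vb) (auto simp: vb_def lookup_single when_def)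
  qed
  then show "Poly_Mapping.lookup u p = Poly_Mapping.lookup v p"
    using assms[of ?w] by simp
qed

text \<open>The transpose of a linear extension: products of operators become nested pairings, with the
  operator applied last innermost.\<close>

lemma pairing_lin_ext:
  "pairing w (lin_ext vscale f u) = pairing (\<lambda>i j k. pairing w (f i j k)) u"
proof (rule linear_eq_on_vb[OF _ linear_pairing])
  show "Vector_Spaces.linear vscale (*) (\<lambda>u. pairing w (lin_ext vscale f u))"
    using Vector_Spaces.linear_compose[OF linear_lin_ext[OF Vsp.vector_space_axioms] linear_pairing]
    by (simp add: o_def)
  show "pairing w (lin_ext vscale f (vb i j k)) = pairing (\<lambda>i j k. pairing w (f i j k)) (vb i j k)" for i j k
    by (simp add: Vsp.vector_space_axioms)
qed

lemmas coeff_defs = h01_co_def h21_co_def h10_co_def h11_co_def h31_co_def h32_co_def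
  s_co_def Sp_def Sm_def Tp_def Tm_def Ap_def Am_def Bp_def Bm_def

lemmas composite_coeff_defs = h10_co_def h11_co_def h31_co_def h32_co_def Ap_def Am_def Bp_def Bm_def

lemmas pairing_simps = pairing.add pairing.diff pairing.neg pairing.scale pairing_vb

text \<open>Translation symmetry.  Every coefficient is affine in \<open>i, j, k\<close>, or built from such functions, and
  a shift of the indices can be absorbed into the parameters.\<close>

lemma pairing_g2_op_translate:
  fixes a1 a2 a3 :: complex and i j k l m n :: int
  defines "b1 \<equiv> a1 + 2 * of_int i - of_int j" and "b2 \<equiv> a2 + of_int j"
    and "b3 \<equiv> a3 - of_int j + 2 * of_int k"
  shows "pairing w (g2_op a1 a2 a3 x (i + l) (j + m) (k + n))
    = pairing (\<lambda>l m n. w (i + l) (j + m) (k + n)) (g2_op b1 b2 b3 x l m n)"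
proof -
  have "h01_co a1 (i + l) (j + m) = h01_co b1 l m"
    "h21_co a2 (i + l) (j + m) = h21_co b2 l m"
    "s_co a3 (j + m) (k + n) = s_co b3 m n"
    "Sp a1 a3 (i + l) (j + m) (k + n) = Sp b1 b3 l m n"
    "Sm a1 a3 (i + l) (k + n) = Sm b1 b3 l n"
    "Tp a2 a3 (j + m) (k + n) = Tp b2 b3 m n"
    "Tm a2 a3 (j + m) (k + n) = Tm b2 b3 m n" for l m n
    by (simp_all add: coeff_defs b1_def b2_def b3_def algebra_simps)
  then show ?thesis
    by (cases x) (simp_all add: pairing_simps composite_coeff_defs add.assoc add_diff_eq[symmetric])
qed

lemma pairing_product_translate:
  fixes a1 a2 a3 :: complex and i j k :: int
  defines "b1 \<equiv> a1 + 2 * of_int i - of_int j" and "b2 \<equiv> a2 + of_int j"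
    and "b3 \<equiv> a3 - of_int j + 2 * of_int k"
  shows "pairing w (lin_ext vscale (g2_op a1 a2 a3 x) (g2_op a1 a2 a3 y i j k))
    = pairing (\<lambda>l m n. pairing (\<lambda>l m n. w (i + l) (j + m) (k + n)) (g2_op b1 b2 b3 x l m n))
        (g2_op b1 b2 b3 y 0 0 0)"
  using pairing_g2_op_translate[of "\<lambda>l m n. pairing w (g2_op a1 a2 a3 x l m n)" a1 a2 a3 y i 0 j 0 k 0]
    pairing_g2_op_translate[of w a1 a2 a3 x i _ j _ k]
  by (simp add: pairing_lin_ext b1_def b2_def b3_def)

section \<open>The commutators at the origin\<close>

text \<open>In the parameters \<open>p = S\<^sup>+\<close>, \<open>t = T\<^sup>+\<close>, \<open>s = s\<^sub>0\<^sub>0\<close> at the origin, every linear coefficient is one of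
  \<open>p, s - p, t, 3 s - t, s\<close> or a combination of them, plus an integer.\<close>

lemma g2_coeff_param:
  fixes p s t :: complex
  defines "a1 \<equiv> 2 * p - s" and "a2 \<equiv> 2 * t - 3 * s" and "a3 \<equiv> s + 1"
  shows "h01_co a1 i j = 2 * p - s + of_int (2 * i - j)"
    "h21_co a2 i j = 2 * t - 3 * s + of_int j"
    "s_co a3 j k = s + of_int (2 * k - j)"
    "Sp a1 a3 i j k = p + of_int (i - j + k)"
    "Sm a1 a3 i k = s - p + of_int (k - i)"
    "Tp a2 a3 j k = t + of_int (3 * k - j)"
    "Tm a2 a3 j k = 3 * s - t + of_int (3 * k - 2 * j)"
  by (simp_all add: coeff_defs a1_def a2_def a3_def field_simps)


lemma nonzero_shifts:
  fixes s :: complex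
  assumes "s \<notin> \<int>"
  shows "s \<noteq> 0" "s + 1 \<noteq> 0" "s - 1 \<noteq> 0" "s + numeral n \<noteq> 0" "s - numeral n \<noteq> 0"
proof -
  have "s \<noteq> of_int z" for z
    using assms by auto
  from this[of 0] this[of 1] this[of "- 1"] this[of "numeral n"] this[of "- numeral n"]
  show "s \<noteq> 0" "s + 1 \<noteq> 0" "s - 1 \<noteq> 0" "s + numeral n \<noteq> 0" "s - numeral n \<noteq> 0"
    by (auto simp: eq_neg_iff_add_eq_0)
qed

text \<open>The left-hand side is the commutator of the two operators on \<open>v\<^sub>0\<^sub>0\<^sub>0\<close>, tested with the functional
  given by \<open>w\<close>.  An even generator contributes a single polynomial factor, so each of the cases is
  an identity between rational functions of low degree.\<close>

lemma origin_commutator_even: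
  fixes p s t :: complex and w :: "int \<Rightarrow> int \<Rightarrow> int \<Rightarrow> complex"
  defines "op \<equiv> g2_op (2 * p - s) (2 * t - 3 * s) (s + 1)"
  assumes s: "s \<notin> \<int>" and xy: "x \<in> even_gens" "y \<in> g2_basis"
  shows "pairing (\<lambda>l m n. pairing w (op x l m n)) (op y 0 0 0)
    - pairing (\<lambda>l m n. pairing w (op y l m n)) (op x 0 0 0)
    = fst (ad x y) * pairing w (op (snd (ad x y)) 0 0 0)"
  using xy unfolding even_gens_def g2_basis_def
  by (elim insertE emptyE; hypsubst; use nonzero_shifts[OF s] in
    \<open>simp add: op_def pairing_simps composite_coeff_defs g2_coeff_param; simp add: divide_simps;
      simp add: algebra_simps power2_eq_square\<close>)

text \<open>The one relation between odd elements that has to be computed.  The product of the two operators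
  reaches the three vectors \<open>v\<^sub>0\<^sub>0\<^sub>k\<close> with \<open>k = -1, 0, 1\<close>, and only \<open>k = 0\<close> survives in the commutator.\<close>

lemma origin_commutator_E32_F32:
  fixes p s t :: complex and w :: "int \<Rightarrow> int \<Rightarrow> int \<Rightarrow> complex"
  defines "op \<equiv> g2_op (2 * p - s) (2 * t - 3 * s) (s + 1)"
  assumes s: "s \<notin> \<int>"
  shows "pairing (\<lambda>l m n. pairing w (op E32 l m n)) (op F32 0 0 0)
    - pairing (\<lambda>l m n. pairing w (op F32 l m n)) (op E32 0 0 0)
    = pairing w (op H32 0 0 0)"
proof -
  \<comment> \<open>Each of \<open>B\<^sup>+\<close>, \<open>B\<^sup>-\<close> has three consecutive factors, collected in the cubic \<open>b\<close>.
     Keeping \<open>b\<close> folded leaves a short expression in which the coefficients can be compared.\<close>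
  define b :: "complex \<Rightarrow> complex" where "b x = x * (x + 1) * (x - 1) / 27" for x
  define u where "u = 3 * s - t"
  have Bp: "Bp (2 * t - 3 * s) (s + 1) j k
      = b (t + of_int (3 * k - j)) / ((s + of_int (2 * k - j)) * (s + of_int (2 * k - (j + 1))))" for j k
  proof -
    have eqs: "t + of_int (3 * k - (j - 1)) = t + of_int (3 * k - j) + 1"
      "t + of_int (3 * k - (j + 1)) = t + of_int (3 * k - j) - 1"
      by simp_all
    show ?thesis
      by (simp only: Bp_def b_def g2_coeff_param eqs; simp only: divide_divide_eq_left mult_ac)
  qed
  have Bm: "Bm (2 * t - 3 * s) (s + 1) j k
      = b (u + of_int (3 * k - 2 * j)) / ((s + of_int (2 * k - j)) * (s + of_int (2 * k - (j + 1))))" for j k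
  proof -
    have eqs: "u + of_int (3 * (k - 1) - 2 * (j - 1)) = u + of_int (3 * k - 2 * j) - 1"
      "u + of_int (3 * (k + 1) - 2 * (j + 1)) = u + of_int (3 * k - 2 * j) + 1"
      by simp_all
    show ?thesis
      by (simp only: Bm_def b_def g2_coeff_param u_def[symmetric] eqs; simp only: divide_divide_eq_left mult_ac)
  qed
  have h32: "h32_co (2 * p - s) (2 * t - 3 * s) 0 0
     = b (u - 3) * (s - p - 1) / ((s - 1) * (s - 2)) - b (t - 3) * (p - 1) / ((s - 1) * (s - 2))
     - b u * (s - p) / (s * (s - 1)) + b t * p / (s * (s - 1))"
    using nonzero_shifts[OF s] unfolding b_def u_def h32_co_def g2_coeff_param
    by (simp add: divide_simps; simp add: algebra_simps power2_eq_square)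
  \<comment> \<open>The terms at \<open>w 0 0 1\<close> cancel because both carry the product \<open>b t * b u * p * (s - p)\<close>
     over the same denominator; the terms at \<open>w 0 0 0\<close> are those of the identity above.\<close>
  show ?thesis
    by (simp add: op_def pairing_simps h32 g2_coeff_param Bp Bm;
        simp add: distrib_left distrib_right left_diff_distrib right_diff_distrib
          add_divide_distrib diff_divide_distrib mult_ac)
qed

section \<open>The action and the reduction to one odd commutator\<close>

lemma g2_mat_in_g2: "g2_mat x \<in> g2"
proof -
  have basis: "g2_mat x \<in> g2" if "x \<in> g2_basis" for x
    unfolding g2_def using that by (auto simp: g2_basis_def intro: mat7.span_base)
  then have "h01_mat \<in> g2" "h10_mat \<in> g2"
    using basis[of H01] basis[of H10] by (simp_all add: g2_basis_def)
  then have "mat_scale c h10_mat + mat_scale d h01_mat \<in> g2" for c d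
    unfolding g2_def by (intro mat7.span_add mat7.span_scale)
  from this[of 1 1] this[of 1 2] this[of 1 3] this[of 2 3] basis[of x] show ?thesis
    by (cases x) (simp_all add: g2_basis_def)
qed

lemma g2_subspace: "mat7.subspace g2"
  unfolding g2_def by (rule mat7.subspace_span)

lemma g2_induct:
  assumes "mat7.subspace {x. P x}" and "\<And>b. b \<in> g2_basis \<Longrightarrow> P (g2_mat b)" and "x \<in> g2"
  shows "P x"
proof -
  have "x \<in> mat7.span (g2_mat ` g2_basis)"
    using assms(3) by (simp add: g2_def g2_basis_def)
  then show ?thesis
    using mat7.span_induct[of x "g2_mat ` g2_basis" P] assms(1,2) by blast
qed

definition odd_roots :: "g2_symbol set" where
  "odd_roots = {E10, F10, E11, F11, E31, F31, E32, F32}"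

lemma ad_odd_roots:
  assumes "z \<in> even_gens" "y \<in> odd_roots"
  shows "fst (ad z y) = 0 \<or> snd (ad z y) \<in> odd_roots"
  using assms unfolding even_gens_def odd_roots_def by auto

lemma g2_basis_cases:
  "g2_basis = even_gens \<union> {H01, H10} \<union> odd_roots"
  by (auto simp: g2_basis_def even_gens_def odd_roots_def)

interpretation Vsp_pair: vector_space_pair vscale vscale
  by unfold_locales

context
  fixes a1 a2 a3 :: complex
  assumes a3: "a3 \<notin> \<int>"
begin

definition g2_act :: "mat7 \<Rightarrow> Vspace \<Rightarrow> Vspace" where
  "g2_act x u = (\<Sum>b\<in>g2_basis. g2_coord b x \<odot> lin_ext vscale (g2_op a1 a2 a3 b) u)"

lemma linear_op: "Vector_Spaces.linear vscale vscale (lin_ext vscale (g2_op a1 a2 a3 b))"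
  by (rule linear_lin_ext) (rule Vsp.vector_space_axioms)

lemma lin_ext_op_vb: "lin_ext vscale (g2_op a1 a2 a3 b) (vb i j k) = g2_op a1 a2 a3 b i j k"
  by (rule lin_ext_vb) (rule Vsp.vector_space_axioms)

lemma linear_g2_act: "Vector_Spaces.linear vscale vscale (g2_act x)"
  unfolding g2_act_def
  by (intro Vsp_pair.linear_compose_sum Vsp_pair.linear_compose_scale_right ballI linear_op)

interpretation g2_act: Vector_Spaces.linear vscale vscale "g2_act x" for x
  by (rule linear_g2_act)

lemma g2_act_add: "g2_act (x + y) u = g2_act x u + g2_act y u"
  by (simp add: g2_act_def g2_coord_add Vsp.scale_left_distrib sum.distrib)

lemma g2_act_scale: "g2_act (mat_scale c x) u = c \<odot> g2_act x u"
  by (simp add: g2_act_def g2_coord_scale Vsp.scale_sum_right)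

lemma g2_act_zero: "g2_act 0 u = 0"
  using g2_act_scale[of 0 0 u] by simp

lemma g2_act_neg: "g2_act (- x) u = - g2_act x u"
  using g2_act_scale[of "- 1" x u] by simp

lemma g2_act_diff: "g2_act (x - y) u = g2_act x u - g2_act y u"
  using g2_act_add[of x "- y" u] by (simp add: g2_act_neg)

text \<open>For the symbols outside the basis this says that the prescribed operators of
  \<open>h\<^sub>1\<^sub>1, h\<^sub>2\<^sub>1, h\<^sub>3\<^sub>1, h\<^sub>3\<^sub>2\<close> are the same combinations of those of \<open>h\<^sub>1\<^sub>0\<close> and \<open>h\<^sub>0\<^sub>1\<close> as the matrices are.\<close>

lemma g2_act_g2_mat: "g2_act (g2_mat b) u = lin_ext vscale (g2_op a1 a2 a3 b) u"
proof -
  have basis: "g2_act (g2_mat b) u = lin_ext vscale (g2_op a1 a2 a3 b) u" if "b \<in> g2_basis" for b u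
  proof -
    have "g2_act (g2_mat b) u
        = (\<Sum>b'\<in>g2_basis. if b' = b then lin_ext vscale (g2_op a1 a2 a3 b') u else 0)"
      unfolding g2_act_def using that by (intro sum.cong) (simp_all add: g2_coord_basis)
    then show ?thesis
      using that by (simp add: g2_basis_def)
  qed
  show ?thesis
  proof (rule linear_eq_on_vb[OF linear_g2_act linear_op])
    fix i j k
    have "g2_act h01_mat (vb i j k) = h01_co a1 i j \<odot> vb i j k"
      "g2_act h10_mat (vb i j k) = h10_co a1 a2 i j \<odot> vb i j k"
      using basis[of H01 "vb i j k"] basis[of H10 "vb i j k"]
      by (simp_all add: g2_basis_def lin_ext_op_vb)
    then show "g2_act (g2_mat b) (vb i j k) = lin_ext vscale (g2_op a1 a2 a3 b) (vb i j k)"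
      using basis[of b "vb i j k"]
      by (cases b) (simp_all add: g2_basis_def lin_ext_op_vb g2_act_add g2_act_scale
          flip: Vsp.scale_left_distrib, simp_all add: coeff_defs field_simps)
  qed
qed

text \<open>Closure of $G_2$ under the bracket is part of the definition, so that the same induction over the
  generators proves it together with the module identity.\<close>

definition compatible :: "mat7 \<Rightarrow> mat7 \<Rightarrow> bool" where
  "compatible x y \<longleftrightarrow> mat_bracket x y \<in> g2 \<and>
     (\<forall>u. g2_act (mat_bracket x y) u = g2_act x (g2_act y u) - g2_act y (g2_act x u))"

text \<open>The bridge from the origin to all of \<open>V\<close>: an identity on \<open>v\<^sub>0\<^sub>0\<^sub>0\<close> that holds for all parameters
  with \<open>s\<close> not an integer holds on each \<open>v\<^sub>i\<^sub>j\<^sub>k\<close> by translation, and then everywhere by linearity.\<close>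

lemma compatible_symbolsI:
  assumes br: "mat_bracket (g2_mat x) (g2_mat y) = mat_scale c (g2_mat z)"
    and origin: "\<And>p s t :: complex. \<And>w op. \<lbrakk>s \<notin> \<int>; op = g2_op (2 * p - s) (2 * t - 3 * s) (s + 1)\<rbrakk> \<Longrightarrow>
      pairing (\<lambda>l m n. pairing w (op x l m n)) (op y 0 0 0)
        - pairing (\<lambda>l m n. pairing w (op y l m n)) (op x 0 0 0) = c * pairing w (op z 0 0 0)"
  shows "compatible (g2_mat x) (g2_mat y)"
  unfolding compatible_def
proof (intro conjI allI)
  show "mat_bracket (g2_mat x) (g2_mat y) \<in> g2"
    unfolding br using g2_mat_in_g2 g2_subspace mat7.subspace_scale by blast
  fix u
  let ?X = "lin_ext vscale (g2_op a1 a2 a3 x)" and ?Y = "lin_ext vscale (g2_op a1 a2 a3 y)"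
  have "c \<odot> lin_ext vscale (g2_op a1 a2 a3 z) u = ?X (?Y u) - ?Y (?X u)"
  proof (rule linear_eq_on_vb[where scl = vscale and f = "\<lambda>u. c \<odot> lin_ext vscale (g2_op a1 a2 a3 z) u"
        and g = "\<lambda>u. ?X (?Y u) - ?Y (?X u)"])
    show "Vector_Spaces.linear vscale vscale (\<lambda>u. c \<odot> lin_ext vscale (g2_op a1 a2 a3 z) u)"
      by (intro Vsp_pair.linear_compose_scale_right linear_op)
    show "Vector_Spaces.linear vscale vscale (\<lambda>u. ?X (?Y u) - ?Y (?X u))"
      using Vector_Spaces.linear_compose[OF linear_op linear_op]
      by (intro Vsp_pair.linear_compose_sub) (simp_all add: o_def)
    fix i j k
    show "c \<odot> lin_ext vscale (g2_op a1 a2 a3 z) (vb i j k) = ?X (?Y (vb i j k)) - ?Y (?X (vb i j k))"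
    proof (rule pairing_eqI)
      fix w
      define b1 b2 b3 where "b1 = a1 + 2 * of_int i - of_int j" and "b2 = a2 + of_int j"
        and "b3 = a3 - of_int j + 2 * of_int k"
      \<comment> \<open>Solved from \<open>b1 = 2 * p - s\<close>, \<open>b2 = 2 * t - 3 * s\<close>, \<open>b3 = s + 1\<close>.\<close>
      define s p t where "s = b3 - 1" and "p = (b1 + s) / 2" and "t = (b2 + 3 * s) / 2"
      have b: "b1 = 2 * p - s" "b2 = 2 * t - 3 * s" "b3 = s + 1"
        by (simp_all add: p_def t_def field_simps) (simp add: s_def)
      have "a3 = s + of_int (j - 2 * k + 1)"
        by (simp add: s_def b3_def)
      then have "s \<notin> \<int>"
        using a3 by (metis Ints_add Ints_of_int)
      note * = origin[OF this refl, of "\<lambda>l m n. w (i + l) (j + m) (k + n)" p t, folded b]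
      show "pairing w (c \<odot> lin_ext vscale (g2_op a1 a2 a3 z) (vb i j k))
          = pairing w (?X (?Y (vb i j k)) - ?Y (?X (vb i j k)))"
        using * pairing_g2_op_translate[of w a1 a2 a3 z i 0 j 0 k 0]
        by (simp add: lin_ext_op_vb pairing.scale pairing.diff pairing_product_translate
            flip: b1_def b2_def b3_def)
    qed
  qed
  then show "g2_act (mat_bracket (g2_mat x) (g2_mat y)) u
      = g2_act (g2_mat x) (g2_act (g2_mat y) u) - g2_act (g2_mat y) (g2_act (g2_mat x) u)"
    by (simp add: br g2_act_scale g2_act_g2_mat)
qed

lemma compatible_even_gens: "\<lbrakk>x \<in> even_gens; y \<in> g2_basis\<rbrakk> \<Longrightarrow> compatible (g2_mat x) (g2_mat y)"
  by (rule compatible_symbolsI[OF mat_bracket_ad]) (simp_all add: origin_commutator_even)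

lemma compatible_E32_F32: "compatible (g2_mat E32) (g2_mat F32)"
  by (rule compatible_symbolsI[where c = 1 and z = H32])
    (simp_all add: mat_bracket_E32_F32 origin_commutator_E32_F32 del: g2_mat.simps g2_op.simps)

lemma subspace_compatible: "mat7.subspace {y. compatible x y}"
  by (rule mat7.subspaceI)
    (auto simp: compatible_def mat_bracket_simps g2_act_add g2_act_scale g2_act_zero g2_act.add
      g2_act.scale Vsp.scale_right_diff_distrib
      intro: mat7.subspace_0 mat7.subspace_add mat7.subspace_scale g2_subspace)

lemma compatible_sym: "compatible x y \<Longrightarrow> compatible y x"
  unfolding compatible_def mat_bracket_swap[of y x]
  by (auto simp: g2_act_neg intro: mat7.subspace_neg g2_subspace)

text \<open>The failure of \<open>\<rho>\<close> to preserve brackets is a bilinear map \<open>D\<close>.  For \<open>z\<close> compatible with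
  everything the Jacobi identity gives \<open>[\<rho> z, D(x, y)] = D([z, x], y) + D(x, [z, y])\<close>, so if \<open>D\<close>
  vanishes at \<open>(x, y)\<close> and at \<open>(x, [z, y])\<close>, it vanishes at \<open>([z, x], y)\<close>.\<close>

lemma compatible_bracket_left:
  assumes z: "\<And>v. v \<in> g2 \<Longrightarrow> compatible z v" and "x \<in> g2" "y \<in> g2"
    and xy: "compatible x y" and xzy: "compatible x (mat_bracket z y)"
  shows "compatible (mat_bracket z x) y"
proof -
  have zxy: "compatible z (mat_bracket x y)" and zx: "compatible z x" and zy: "compatible z y"
    using assms unfolding compatible_def by auto
  have "mat_bracket (mat_bracket z x) y \<in> g2"
    using zxy xzy unfolding mat_bracket_derivation compatible_def
    by (blast intro: mat7.subspace_diff g2_subspace)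
  moreover have "g2_act (mat_bracket (mat_bracket z x) y) u
      = g2_act (mat_bracket z x) (g2_act y u) - g2_act y (g2_act (mat_bracket z x) u)" for u
    using zxy xzy xy zx zy
    by (simp add: mat_bracket_derivation compatible_def g2_act_diff g2_act.diff)
  ultimately show ?thesis
    by (simp add: compatible_def)
qed

definition compatible_g2 :: "mat7 \<Rightarrow> bool" where
  "compatible_g2 x \<longleftrightarrow> (\<forall>y\<in>g2. compatible x y)"

lemma compatible_g2I: "(\<And>b. b \<in> g2_basis \<Longrightarrow> compatible x (g2_mat b)) \<Longrightarrow> compatible_g2 x"
  unfolding compatible_g2_def using g2_induct[OF subspace_compatible] by blast

lemma subspace_compatible_g2: "mat7.subspace {x. compatible_g2 x}"
proof -
  have "{x. compatible_g2 x} = (\<Inter>y\<in>g2. {x. compatible y x})"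
    by (auto simp: compatible_g2_def intro: compatible_sym)
  then show ?thesis
    by (auto intro: mat7.subspace_Inter subspace_compatible)
qed

lemma compatible_g2_bracket:
  assumes "compatible_g2 z" "compatible_g2 x" "x \<in> g2"
  shows "compatible_g2 (mat_bracket z x)"
proof -
  have "compatible (mat_bracket z x) y" if "y \<in> g2" for y
  proof (rule compatible_bracket_left)
    show "compatible x (mat_bracket z y)"
      using assms that unfolding compatible_g2_def compatible_def[of z] by blast
  qed (use assms that in \<open>auto simp: compatible_g2_def\<close>)
  then show ?thesis
    by (simp add: compatible_g2_def)
qed

text \<open>The even part is generated by its four root vectors: \<open>[e\<^sub>0\<^sub>1, f\<^sub>0\<^sub>1] = h\<^sub>0\<^sub>1\<close> and \<open>[e\<^sub>2\<^sub>1, f\<^sub>2\<^sub>1] = h\<^sub>2\<^sub>1\<close>,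
  and \<open>h\<^sub>1\<^sub>0\<close> is a combination of these two.\<close>

lemma compatible_g2_even:
  assumes "x \<in> even_gens \<union> {H01, H10}"
  shows "compatible_g2 (g2_mat x)"
proof -
  have gens: "compatible_g2 (g2_mat x)" if "x \<in> even_gens" for x
    using that by (intro compatible_g2I compatible_even_gens)
  have "compatible_g2 (mat_bracket (g2_mat E01) (g2_mat F01))"
    "compatible_g2 (mat_bracket (g2_mat E21) (g2_mat F21))"
    by (auto intro!: compatible_g2_bracket gens g2_mat_in_g2 simp: even_gens_def simp del: g2_mat.simps)
  then have H: "compatible_g2 (g2_mat H01)" "compatible_g2 (g2_mat H21)"
    by (simp_all add: mat_bracket_ad even_gens_def g2_basis_def del: g2_mat.simps)
  have "g2_mat H10 = mat_scale (1 / 2) (g2_mat H21 - mat_scale 3 (g2_mat H01))"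
    by (simp add: mat7.scale_right_distrib)
  then have "compatible_g2 (g2_mat H10)"
    using H subspace_compatible_g2
    by (metis (no_types, lifting) mem_Collect_eq mat7.subspace_diff mat7.subspace_scale)
  then show ?thesis
    using assms gens H by blast
qed

text \<open>An even generator \<open>z\<close> that kills \<open>x\<close> moves the second argument freely, because
  \<open>D(x, [z, y]) = [\<rho> z, D(x, y)]\<close>.\<close>

lemma compatible_raise:
  assumes z: "z \<in> even_gens" and "x \<in> g2_basis" "y \<in> g2_basis"
    and "fst (ad z x) = 0" "fst (ad z y) \<noteq> 0"
    and xy: "compatible (g2_mat x) (g2_mat y)"
  shows "compatible (g2_mat x) (g2_mat (snd (ad z y)))"
proof -
  have zx: "mat_bracket (g2_mat z) (g2_mat x) = 0"
    and zy: "g2_mat (snd (ad z y)) = mat_scale (1 / fst (ad z y)) (mat_bracket (g2_mat z) (g2_mat y))"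
    using assms by (simp_all add: mat_bracket_ad)
  have "compatible (mat_bracket (g2_mat z) (g2_mat y)) (g2_mat x)"
  proof (rule compatible_bracket_left)
    show "compatible (g2_mat y) (mat_bracket (g2_mat z) (g2_mat x))"
      unfolding zx using mat7.subspace_0[OF subspace_compatible] by blast
    show "\<And>v. v \<in> g2 \<Longrightarrow> compatible (g2_mat z) v"
      using compatible_g2_even z unfolding compatible_g2_def by blast
  qed (use xy in \<open>auto intro: compatible_sym g2_mat_in_g2\<close>)
  then show ?thesis
    unfolding zy using mat7.subspace_scale[OF subspace_compatible] compatible_sym by blast
qed

text \<open>Once \<open>x\<close> is compatible with the whole odd part, which is stable under \<open>z\<close>, so is \<open>[z, x]\<close>.\<close>

lemma compatible_lower:
  assumes z: "z \<in> even_gens" and "x \<in> g2_basis" "fst (ad z x) \<noteq> 0"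
    and x: "\<And>y. y \<in> odd_roots \<Longrightarrow> compatible (g2_mat x) (g2_mat y)" and y: "y \<in> odd_roots"
  shows "compatible (g2_mat (snd (ad z x))) (g2_mat y)"
proof -
  have zx: "g2_mat (snd (ad z x)) = mat_scale (1 / fst (ad z x)) (mat_bracket (g2_mat z) (g2_mat x))"
    using assms by (simp add: mat_bracket_ad)
  have "mat_bracket (g2_mat z) (g2_mat y) = mat_scale (fst (ad z y)) (g2_mat (snd (ad z y)))"
    using z y by (simp add: mat_bracket_ad g2_basis_cases)
  then have "compatible (g2_mat x) (mat_bracket (g2_mat z) (g2_mat y))"
    using ad_odd_roots[OF z y] x mat7.subspace_scale[OF subspace_compatible]
      mat7.subspace_0[OF subspace_compatible] by fastforce
  then have "compatible (mat_bracket (g2_mat z) (g2_mat x)) (g2_mat y)"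
    using compatible_bracket_left[of "g2_mat z" "g2_mat x" "g2_mat y"] x[OF y] g2_mat_in_g2
      compatible_g2_even[of z] z unfolding compatible_g2_def by blast
  then show ?thesis
    unfolding zx using mat7.subspace_scale[OF subspace_compatible] compatible_sym by blast
qed

text \<open>The pair of the highest and the lowest odd vector generates all odd pairs under the even part.
  The raising steps start at \<open>f\<^sub>3\<^sub>2\<close> with \<open>e\<^sub>3\<^sub>2\<close> kept fixed, the lowering steps start at \<open>e\<^sub>3\<^sub>2\<close>.\<close>

lemma compatible_odd:
  assumes "x \<in> odd_roots" "y \<in> odd_roots"
  shows "compatible (g2_mat x) (g2_mat y)"
proof -
  have raise: "compatible (g2_mat E32) (g2_mat (snd (ad z y)))"
    if "compatible (g2_mat E32) (g2_mat y)" "z \<in> {E01, E21}" "y \<in> g2_basis" "fst (ad z y) \<noteq> 0"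
    for z y
    using that by (intro compatible_raise) (auto simp: even_gens_def g2_basis_def)
  have F32: "compatible (g2_mat E32) (g2_mat F32)" by (rule compatible_E32_F32)
  have F11: "compatible (g2_mat E32) (g2_mat F11)" using raise[OF F32, of E21] by (simp add: g2_basis_def del: g2_mat.simps)
  have E10: "compatible (g2_mat E32) (g2_mat E10)" using raise[OF F11, of E21] by (simp add: g2_basis_def del: g2_mat.simps)
  have E31: "compatible (g2_mat E32) (g2_mat E31)" using raise[OF E10, of E21] by (simp add: g2_basis_def del: g2_mat.simps)
  have F31: "compatible (g2_mat E32) (g2_mat F31)" using raise[OF F32, of E01] by (simp add: g2_basis_def del: g2_mat.simps)
  have F10: "compatible (g2_mat E32) (g2_mat F10)" using raise[OF F11, of E01] by (simp add: g2_basis_def del: g2_mat.simps)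
  have E11: "compatible (g2_mat E32) (g2_mat E11)" using raise[OF E10, of E01] by (simp add: g2_basis_def del: g2_mat.simps)
  have E32: "compatible (g2_mat E32) (g2_mat E32)" using raise[OF E31, of E01] by (simp add: g2_basis_def del: g2_mat.simps)
  define good where "good x \<longleftrightarrow> (\<forall>y\<in>odd_roots. compatible (g2_mat x) (g2_mat y))" for x
  have lower: "good (snd (ad z x))"
    if "good x" "z \<in> {F01, F21}" "x \<in> g2_basis" "fst (ad z x) \<noteq> 0" for z x
    using that compatible_lower[of z x] by (auto simp: good_def even_gens_def)
  have E32: "good E32"
    unfolding good_def odd_roots_def using F32 F11 E10 E31 F31 F10 E11 E32 by blast
  have E31: "good E31" using lower[OF E32, of F01] by (simp add: g2_basis_def del: g2_mat.simps)
  have E11: "good E11" using lower[OF E32, of F21] by (simp add: g2_basis_def del: g2_mat.simps)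
  have E10: "good E10" using lower[OF E31, of F21] by (simp add: g2_basis_def del: g2_mat.simps)
  have F10: "good F10" using lower[OF E11, of F21] by (simp add: g2_basis_def del: g2_mat.simps)
  have F11: "good F11" using lower[OF E10, of F21] by (simp add: g2_basis_def del: g2_mat.simps)
  have F31: "good F31" using lower[OF F10, of F21] by (simp add: g2_basis_def del: g2_mat.simps)
  have F32: "good F32" using lower[OF F11, of F21] by (simp add: g2_basis_def del: g2_mat.simps)
  show ?thesis
    using assms F32 F11 E10 E31 F31 F10 E11 E32 unfolding good_def odd_roots_def by blast
qed

lemma compatible_all:
  assumes "x \<in> g2" "y \<in> g2"
  shows "compatible x y"
proof -
  have "compatible_g2 (g2_mat b)" if "b \<in> g2_basis" for b
  proof (rule compatible_g2I)
    fix b' assume "b' \<in> g2_basis"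
    with that show "compatible (g2_mat b) (g2_mat b')"
      using compatible_g2_even compatible_odd g2_mat_in_g2 compatible_sym
      unfolding g2_basis_cases compatible_g2_def by blast
  qed
  then have "compatible_g2 x"
    using g2_induct[OF subspace_compatible_g2 _ assms(1)] by blast
  then show ?thesis
    using assms(2) by (simp add: compatible_g2_def)
qed

lemma lie_module_g2_act: "lie_module mat_scale g2 mat_bracket vscale g2_act"
proof unfold_locales
  show "mat7.subspace g2" by (rule g2_subspace)
  show "mat_bracket x y \<in> g2" if "x \<in> g2" "y \<in> g2" for x y
    using compatible_all[OF that] by (simp add: compatible_def)
  show "g2_act (mat_bracket x y) u = g2_act x (g2_act y u) - g2_act y (g2_act x u)"
    if "x \<in> g2" "y \<in> g2" for x y u
    using compatible_all[OF that] by (simp add: compatible_def)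
  show "mat_bracket x (mat_bracket y z) + mat_bracket y (mat_bracket z x)
      + mat_bracket z (mat_bracket x y) = 0" for x y z
    by (simp add: mat_bracket_def matrix_diff_distrib matrix_mul_assoc algebra_simps)
qed (simp_all add: mat_bracket_add mat_bracket_scale g2_act_add g2_act_scale linear_g2_act
    g2_act.add g2_act.scale mat_bracket_def[of x x for x])

end

theorem theorem6p4:
  fixes a1 a2 a3 :: complex
  assumes "a3 \<notin> \<int>"
  shows "\<exists>act :: mat7 \<Rightarrow> Vspace \<Rightarrow> Vspace.
           lie_module mat_scale g2 mat_bracket vscale act \<and>
           (\<forall>x i j k. act (g2_mat x) (vb i j k) = g2_op a1 a2 a3 x i j k)"
proof (intro exI conjI allI)
  show "lie_module mat_scale g2 mat_bracket vscale (g2_act a1 a2 a3)"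
    by (rule lie_module_g2_act[OF assms])
  show "g2_act a1 a2 a3 (g2_mat x) (vb i j k) = g2_op a1 a2 a3 x i j k" for x i j k
    by (simp only: g2_act_g2_mat[OF assms] lin_ext_op_vb[OF assms])
qed

end
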